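(* Suppose $\{d_n\}_{n\ge0}$ is a non-negative sequence, $0<q<1$ is fixed, and $d(\mu;x)$ is the (formal) power series in $x$ $$d(\mu;x)=\sum_{n=0}^{\infty}d_n\Gamma_q(\mu+n)x^n .$$ Then the generalized Turánian $$\Delta_d(\alpha,\beta;x)=d(\mu+\alpha;x)d(\mu+\beta;x)-d(\mu;x)d(\mu+\alpha+\beta;x)$$ has negative coefficients at all powers of $x$ for all $\mu,\alpha,\beta>0$. In particular, the function $\mu\mapsto d(\mu;x)$ is log-convex on $(0,\infty)$ for each fixed $x>0$ in the domain of convergence.
   Context: For $0<q<1$: $(a;q)_0=1$, $(a;q)_n=\prod_{k=0}^{n-1}(1-aq^k)$ for $n\ge1$, $(a;q)_\infty=\lim_{n\to\infty}(a;q)_n$, and the $q$-gamma function is $\Gamma_q(z)=(1-q)^{1-z}\dfrac{(q;q)_\infty}{(q^z;q)_\infty}$. A positive function is log-convex if its logarithm is convex.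
   Formalization: Since d_n may vanish, "negative coefficients" is proved as: every coefficient is ≤ 0, and the one at x^n is < 0 whenever d_k d_{n-k} ≠ 0 for some k ≤ n (otherwise it is 0). Log-convexity is stated for sequences not identically zero, as it requires positivity. *)

theory Defs
  imports "HOL-Analysis.Analysis"
begin

definition qpoch :: "real \<Rightarrow> real \<Rightarrow> nat \<Rightarrow> real" where
  "qpoch a q n = (\<Prod>k<n. 1 - a * q ^ k)"

definition qpoch_inf :: "real \<Rightarrow> real \<Rightarrow> real" where
  "qpoch_inf a q = lim (\<lambda>n. qpoch a q n)"

definition qGamma :: "real \<Rightarrow> real \<Rightarrow> real" where
  "qGamma q z = (1 - q) powr (1 - z) * qpoch_inf q q / qpoch_inf (q powr z) q"

definition dseries :: "real \<Rightarrow> (nat \<Rightarrow> real) \<Rightarrow> real \<Rightarrow> real fps" where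
  "dseries q d \<mu> = Abs_fps (\<lambda>n. d n * qGamma q (\<mu> + real n))"

definition turanian :: "real \<Rightarrow> (nat \<Rightarrow> real) \<Rightarrow> real \<Rightarrow> real \<Rightarrow> real \<Rightarrow> real fps" where
  "turanian q d \<mu> \<alpha> \<beta> =
     dseries q d (\<mu> + \<alpha>) * dseries q d (\<mu> + \<beta>) - dseries q d \<mu> * dseries q d (\<mu> + \<alpha> + \<beta>)"

text \<open>All points of convergence, so that boundary points of the disc of convergence are included;
  \<^const>\<open>fps_conv_radius\<close> alone would only describe its interior.\<close>

definition conv_domain :: "real fps \<Rightarrow> real set" where
  "conv_domain F = {x. summable (\<lambda>n. fps_nth F n * x ^ n)}"

text \<open>Positivity is part of the definition, since \<^term>\<open>ln\<close> is also defined outside the positive reals.\<close>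

definition log_convex_on :: "real set \<Rightarrow> (real \<Rightarrow> real) \<Rightarrow> bool" where
  "log_convex_on S f \<longleftrightarrow> (\<forall>s\<in>S. f s > 0) \<and> convex_on S (\<lambda>s. ln (f s))"

end

theory Submission
  imports Defs
begin

text \<open>Each factor $1/(1 - q^{z+k})$ of $\Gamma_q$ is strictly log-convex in $z$, so
  $\Gamma_q$ is too. Grouping the terms with indices $k$ and $n - k$ (say $k \le n - k$) in the $n$-th Turanian
  coefficient gives $u + v - r - s$ with $u, v < r$ and $u v \le r s$, whence
  $(r - u)(r - v) > 0$ forces $u + v < r + s$. Log-convexity of the series is Hoelder's inequality,
  obtained from Young's inequality after normalising both sums.\<close>

section \<open>Young's and Hoelder's inequalities\<close>

lemma powr_Young:
  fixes a b t :: real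
  assumes "0 < t" "t < 1" "0 \<le> a" "0 \<le> b"
  shows "a powr (1 - t) * b powr t \<le> (1 - t) * a + t * b"
  using Youngs_inequality_0[of "1 - t" t a b] assms
  by (cases "a = 0"; cases "b = 0") auto

text \<open>Young's inequality is added up for the pairs (1 - a, 1 - b) and (a, b): the right-hand
  sides sum to 1. This yields log-concavity of each factor 1 - q^(z+k) with arbitrary
  weights.\<close>

lemma one_minus_powr_mult_le:
  fixes a b t :: real
  assumes "0 < t" "t < 1" "0 \<le> a" "a < 1" "0 \<le> b" "b < 1"
  shows "(1 - a) powr (1 - t) * (1 - b) powr t \<le> 1 - a powr (1 - t) * b powr t"
  using powr_Young[of t "1 - a" "1 - b"] powr_Young[of t a b] assms
  by (simp add: algebra_simps)

lemma add_less_add_of_mult_le: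
  fixes r s u v :: real
  assumes "u < r" "v < r" "0 < r" "u * v \<le> r * s"
  shows "u + v < r + s"
proof -
  have "0 < (r - u) * (r - v)" using assms by simp
  \<comment> \<open>The difference of the two sides is r s - u v.\<close>
  also have "\<dots> \<le> r * (r + s - (u + v))" using assms by (simp add: algebra_simps)
  finally show ?thesis using assms(3) by (simp add: zero_less_mult_iff)
qed

text \<open>A separate summable minorant \<open>h\<close> lets the series at an intermediate
  parameter play this role, so the series of geometric means itself is never shown to
  converge.\<close>

lemma suminf_powr_Hoelder:
  fixes f g h :: "nat \<Rightarrow> real"
  assumes t: "0 < t" "t < 1"
    and f: "summable f" "\<And>n. 0 \<le> f n" "0 < suminf f"
    and g: "summable g" "\<And>n. 0 \<le> g n" "0 < suminf g"
    and h: "summable h" "\<And>n. h n \<le> f n powr (1 - t) * g n powr t"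
  shows "suminf h \<le> suminf f powr (1 - t) * suminf g powr t"
proof -
  let ?F = "suminf f" and ?G = "suminf g"
  let ?C = "?F powr (1 - t) * ?G powr t"
  have C: "?C > 0" using f g by simp
  have "h n \<le> ?C * ((1 - t) * (f n / ?F) + t * (g n / ?G))" for n
  proof -
    have "h n \<le> ?C * ((f n / ?F) powr (1 - t) * (g n / ?G) powr t)"
      using h(2)[of n] f g by (simp add: powr_divide)
    also have "\<dots> \<le> ?C * ((1 - t) * (f n / ?F) + t * (g n / ?G))"
      using C f g t by (intro mult_left_mono powr_Young) (auto intro: less_imp_le)
    finally show ?thesis .
  qed
  \<comment> \<open>Each normalised series sums to 1, so the weights 1 - t and t leave exactly
    \<open>?C\<close>.\<close>
  moreover have "(\<lambda>n. ?C * ((1 - t) * (f n / ?F) + t * (g n / ?G))) sums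
      (?C * ((1 - t) * (?F / ?F) + t * (?G / ?G)))"
    using f(1) g(1) by (intro sums_mult sums_add sums_divide summable_sums)
  ultimately have "suminf h \<le> ?C * ((1 - t) * (?F / ?F) + t * (?G / ?G))"
    using h(1) by (meson sums_le summable_sums)
  then show ?thesis using f g by simp
qed

section \<open>The infinite q-Pochhammer symbol\<close>

context
  fixes q :: real
  assumes q: "0 < q" "q < 1"
begin

lemma q_factor_pos:
  assumes "0 \<le> a" "a < 1"
  shows "0 < 1 - a * q ^ k"
proof -
  have "a * q ^ k \<le> a * 1" using assms q by (intro mult_left_mono power_le_one) auto
  then show ?thesis using assms by simp
qed

text \<open>The value of \<open>lim\<close> is meaningful only once convergence is known; it follows
  from the geometric series of the a q^k. A product that is \<open>convergent_prod\<close> with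
  nonzero factors has a nonzero value, which makes the positivity strict.\<close>

lemma qpoch_inf_limit:
  assumes "0 \<le> a" "a < 1"
  shows qpoch_tendsto: "qpoch a q \<longlonglongrightarrow> qpoch_inf a q"
    and qpoch_inf_pos: "0 < qpoch_inf a q"
proof -
  have "summable (\<lambda>k. norm ((1 - a * q ^ k) - 1))"
    using assms q by (simp add: abs_mult summable_mult)
  then have conv: "convergent_prod (\<lambda>k. 1 - a * q ^ k)"
    by (intro abs_convergent_prod_imp_convergent_prod summable_imp_abs_convergent_prod)
  then have lim: "qpoch a q \<longlonglongrightarrow> prodinf (\<lambda>k. 1 - a * q ^ k)"
    unfolding qpoch_def by (intro has_prod_imp_tendsto' convergent_prod_has_prod)
  then have eq: "qpoch_inf a q = prodinf (\<lambda>k. 1 - a * q ^ k)"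
    unfolding qpoch_inf_def by (rule limI)
  show "qpoch a q \<longlonglongrightarrow> qpoch_inf a q" using lim eq by simp
  show "0 < qpoch_inf a q"
    unfolding eq using conv q_factor_pos[OF assms] by (intro less_0_prodinf) auto
qed

text \<open>The factor k = 0 is split off so that a strict inequality can be placed there: passing
  to the limit of partial products preserves only non-strict ones.\<close>

lemma qpoch_inf_rec:
  assumes "0 \<le> a" "a < 1"
  shows "qpoch_inf a q = (1 - a) * qpoch_inf (a * q) q"
proof -
  have aq: "0 \<le> a * q" "a * q < 1"
    using assms q mult_strict_mono[of a 1 q 1] by auto
  have "qpoch a q (Suc n) = (1 - a) * qpoch (a * q) q n" for n
    unfolding qpoch_def prod.lessThan_Suc_shift by (simp add: mult.assoc)
  then have "(\<lambda>n. qpoch a q (Suc n)) \<longlonglongrightarrow> (1 - a) * qpoch_inf (a * q) q"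
    using tendsto_mult_left[OF qpoch_tendsto[OF aq]] by simp
  then show ?thesis
    using LIMSEQ_unique LIMSEQ_Suc[OF qpoch_tendsto[OF assms]] by blast
qed

lemma qpoch_inf_antimono:
  assumes "0 \<le> a" "a \<le> b" "b < 1"
  shows "qpoch_inf b q \<le> qpoch_inf a q"
proof (rule LIMSEQ_le)
  show "qpoch b q \<longlonglongrightarrow> qpoch_inf b q" "qpoch a q \<longlonglongrightarrow> qpoch_inf a q"
    using assms by (auto intro!: qpoch_tendsto)
  show "\<exists>N. \<forall>n\<ge>N. qpoch b q n \<le> qpoch a q n"
    unfolding qpoch_def using assms q q_factor_pos[of b]
    by (intro exI allI impI prod_mono) (auto intro!: mult_right_mono less_imp_le)
qed

text \<open>Factorwise comparison: with y = x q^k, the k-th factor on the right minus the one on the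
  left is y (1 - a) (1 - b).\<close>

lemma qpoch_inf_mult_le:
  assumes "0 \<le> x" "x < 1" "0 \<le> a" "a \<le> 1" "0 \<le> b" "b \<le> 1"
  shows "qpoch_inf x q * qpoch_inf (x * a * b) q \<le> qpoch_inf (x * a) q * qpoch_inf (x * b) q"
proof (rule LIMSEQ_le)
  have xa: "0 \<le> x * a" "x * a < 1" and xb: "0 \<le> x * b" "x * b < 1"
    using assms mult_left_le[of a x] mult_left_le[of b x] by auto
  then have xab: "0 \<le> x * a * b" "x * a * b < 1"
    using assms mult_left_le[of b "x * a"] by auto
  show "(\<lambda>n. qpoch x q n * qpoch (x * a * b) q n) \<longlonglongrightarrow> qpoch_inf x q * qpoch_inf (x * a * b) q"
    "(\<lambda>n. qpoch (x * a) q n * qpoch (x * b) q n) \<longlonglongrightarrow> qpoch_inf (x * a) q * qpoch_inf (x * b) q"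
    using assms xa xb xab by (auto intro!: tendsto_mult qpoch_tendsto)
  have "(1 - x * q ^ k) * (1 - x * a * b * q ^ k) \<le> (1 - x * a * q ^ k) * (1 - x * b * q ^ k)" for k
  proof -
    have "0 \<le> x * q ^ k * ((1 - a) * (1 - b))" using assms q by simp
    then show ?thesis by (simp add: algebra_simps)
  qed
  then show "\<exists>N. \<forall>n\<ge>N. qpoch x q n * qpoch (x * a * b) q n \<le> qpoch (x * a) q n * qpoch (x * b) q n"
    unfolding qpoch_def prod.distrib[symmetric]
    using assms xab q_factor_pos[of x] q_factor_pos[of "x * a * b"]
    by (intro exI allI impI prod_mono) (auto intro!: mult_nonneg_nonneg less_imp_le)
qed

text \<open>Strictness comes from the factor k = 0 alone; the remaining product is the non-strict
  case at x q.\<close>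

lemma qpoch_inf_mult_less:
  assumes "0 < x" "x < 1" "0 < a" "a < 1" "0 < b" "b < 1"
  shows "qpoch_inf x q * qpoch_inf (x * a * b) q < qpoch_inf (x * a) q * qpoch_inf (x * b) q"
proof -
  have shrink: "0 < y * c \<and> y * c < 1" if "0 < y" "y < 1" "0 < c" "c < 1" for y c :: real
    using that mult_strict_mono[of y 1 c 1] by auto
  have xa: "0 < x * a" "x * a < 1" and xb: "0 < x * b" "x * b < 1" and xq: "0 < x * q" "x * q < 1"
    using shrink assms q by auto
  have xab: "0 < x * a * b" "x * a * b < 1" using shrink[of "x * a" b] xa assms by auto
  have xaq: "0 < x * a * q" "x * a * q < 1" and xbq: "0 < x * b * q" "x * b * q < 1"
    using shrink xa xb q by auto
  have le: "qpoch_inf (x * q) q * qpoch_inf (x * a * b * q) q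
      \<le> qpoch_inf (x * a * q) q * qpoch_inf (x * b * q) q"
    using qpoch_inf_mult_le[of "x * q" a b] assms xq by (simp add: mult_ac)
  have "0 < x * ((1 - a) * (1 - b))" using assms by simp
  then have less: "(1 - x) * (1 - x * a * b) < (1 - x * a) * (1 - x * b)"
    by (simp add: algebra_simps)
  have "qpoch_inf x q * qpoch_inf (x * a * b) q
      = ((1 - x) * (1 - x * a * b)) * (qpoch_inf (x * q) q * qpoch_inf (x * a * b * q) q)"
    using qpoch_inf_rec[of x] qpoch_inf_rec[of "x * a * b"] assms xab by simp
  also have "\<dots> \<le> ((1 - x) * (1 - x * a * b)) * (qpoch_inf (x * a * q) q * qpoch_inf (x * b * q) q)"
    using le assms xab by (intro mult_left_mono) auto
  also have "\<dots> < ((1 - x * a) * (1 - x * b)) * (qpoch_inf (x * a * q) q * qpoch_inf (x * b * q) q)"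
    using less xaq xbq by (intro mult_strict_right_mono) (auto intro!: mult_pos_pos qpoch_inf_pos)
  also have "\<dots> = qpoch_inf (x * a) q * qpoch_inf (x * b) q"
    using qpoch_inf_rec[of "x * a"] qpoch_inf_rec[of "x * b"] xa xb by simp
  finally show ?thesis .
qed

section \<open>Positivity and log-convexity of the q-gamma function\<close>

lemma q_powr_bounds:
  assumes "0 < z"
  shows "0 < q powr z" "q powr z < 1"
  using assms q powr_less_mono2[of z q 1] by auto

lemma qGamma_pos:
  assumes "0 < z"
  shows "0 < qGamma q z"
  unfolding qGamma_def using q q_powr_bounds[OF assms]
  by (intro divide_pos_pos mult_pos_pos qpoch_inf_pos) auto

text \<open>Both pairs of arguments have sum 2 x + a + b, so the two products share the numerator
  \<open>c\<close>, and taking reciprocals reverses the strict inequality between the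
  denominators.\<close>

lemma qGamma_mult_less:
  assumes "0 < x" "0 < a" "0 < b"
  shows "qGamma q (x + a) * qGamma q (x + b) < qGamma q x * qGamma q (x + a + b)"
proof -
  let ?P = "\<lambda>z. qpoch_inf (q powr z) q"
  have less: "?P x * ?P (x + a + b) < ?P (x + a) * ?P (x + b)"
    using qpoch_inf_mult_less[of "q powr x" "q powr a" "q powr b"] assms q_powr_bounds
    by (simp add: powr_add)
  have pos: "0 < ?P z" if "0 < z" for z
    using q_powr_bounds[OF that] by (intro qpoch_inf_pos) auto
  define c where "c = (1 - q) powr (2 - 2 * x - a - b) * (qpoch_inf q q)\<^sup>2"
  have c: "0 < c" unfolding c_def using q qpoch_inf_pos[of q] by simp
  have eq: "qGamma q y * qGamma q z = c / (?P y * ?P z)" if "y + z = 2 * x + a + b" for y z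
  proof -
    have "2 - 2 * x - a - b = (1 - y) + (1 - z)" using that by simp
    then have "(1 - q) powr (2 - 2 * x - a - b) = (1 - q) powr (1 - y) * (1 - q) powr (1 - z)"
      by (simp only: powr_add)
    then show ?thesis unfolding c_def qGamma_def by (simp add: power2_eq_square)
  qed
  have "c / (?P (x + a) * ?P (x + b)) < c / (?P x * ?P (x + a + b))"
    using less c pos assms by (intro divide_strict_left_mono) (auto intro!: mult_pos_pos)
  then show ?thesis using eq[of "x + a" "x + b"] eq[of x "x + a + b"] by simp
qed

text \<open>Log-concavity of the single factors passes to partial products and to the limit. This
  weighted, non-strict counterpart of the four-point inequality is what the Hoelder argument
  requires.\<close>

lemma qpoch_inf_powr_mult_le:
  assumes t: "0 < t" "t < 1" and yz: "0 < y" "0 < z"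
  shows "qpoch_inf (q powr y) q powr (1 - t) * qpoch_inf (q powr z) q powr t
      \<le> qpoch_inf (q powr ((1 - t) * y + t * z)) q"
proof (rule LIMSEQ_le)
  let ?w = "(1 - t) * y + t * z"
  have w: "0 < ?w" using assms by (intro add_pos_pos mult_pos_pos) auto
  note bounds = q_powr_bounds[OF yz(1)] q_powr_bounds[OF yz(2)] q_powr_bounds[OF w]
  have pos: "0 < qpoch_inf (q powr y) q" "0 < qpoch_inf (q powr z) q"
    using bounds by (auto intro!: qpoch_inf_pos)
  show "(\<lambda>n. qpoch (q powr y) q n powr (1 - t) * qpoch (q powr z) q n powr t)
      \<longlonglongrightarrow> qpoch_inf (q powr y) q powr (1 - t) * qpoch_inf (q powr z) q powr t"
    using bounds pos by (intro tendsto_mult tendsto_powr qpoch_tendsto tendsto_const) auto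
  show "qpoch (q powr ?w) q \<longlonglongrightarrow> qpoch_inf (q powr ?w) q"
    using bounds by (intro qpoch_tendsto) auto
  have factor: "(1 - q powr y * q ^ k) powr (1 - t) * (1 - q powr z * q ^ k) powr t
      \<le> 1 - q powr ?w * q ^ k" for k
  proof -
    have eq: "q powr s * q ^ k = q powr (s + k)" for s
      using q by (simp add: powr_add powr_realpow)
    \<comment> \<open>The weights sum to 1, so moving both points by k moves their mean by k; thus
      q^(\<open>?w\<close> + k) is the weighted geometric mean of q^(y+k) and q^(z+k).\<close>
    have "?w + k = (y + k) * (1 - t) + (z + k) * t" by (simp add: algebra_simps)
    then have "q powr (?w + k) = (q powr (y + k)) powr (1 - t) * (q powr (z + k)) powr t"
      by (simp only: powr_powr flip: powr_add)
    then show ?thesis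
      unfolding eq using one_minus_powr_mult_le[of t "q powr (y + k)" "q powr (z + k)"] t
        q_powr_bounds[of "y + k"] q_powr_bounds[of "z + k"] yz by simp
  qed
  show "\<exists>N. \<forall>n\<ge>N. qpoch (q powr y) q n powr (1 - t) * qpoch (q powr z) q n powr t
      \<le> qpoch (q powr ?w) q n"
    unfolding qpoch_def prod_powr_distrib prod.distrib[symmetric]
    using factor by (intro exI allI impI prod_mono) auto
qed

text \<open>The logarithm of the numerator \<open>?N\<close> is affine in its argument, so the
  numerators contribute an equality; the inequality is that of the denominators, inverted.\<close>

lemma qGamma_convex_comb_le:
  assumes t: "0 < t" "t < 1" and yz: "0 < y" "0 < z"
  shows "qGamma q ((1 - t) * y + t * z) \<le> qGamma q y powr (1 - t) * qGamma q z powr t"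
proof -
  let ?w = "(1 - t) * y + t * z" and ?P = "\<lambda>s. qpoch_inf (q powr s) q"
  let ?N = "\<lambda>s. (1 - q) powr (1 - s) * qpoch_inf q q"
  have w: "0 < ?w" using assms by (intro add_pos_pos mult_pos_pos) auto
  have pos: "0 < ?P s" if "0 < s" for s
    using q_powr_bounds[OF that] by (intro qpoch_inf_pos) auto
  have Q: "0 < qpoch_inf q q" using q by (intro qpoch_inf_pos) auto
  have "1 - ?w = (1 - y) * (1 - t) + (1 - z) * t" by (simp add: algebra_simps)
  then have "(1 - q) powr (1 - ?w)
      = ((1 - q) powr (1 - y)) powr (1 - t) * ((1 - q) powr (1 - z)) powr t"
    by (simp only: powr_powr powr_add)
  moreover have "qpoch_inf q q = qpoch_inf q q powr (1 - t) * qpoch_inf q q powr t"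
    using Q by (simp flip: powr_add)
  ultimately have N: "?N ?w = ?N y powr (1 - t) * ?N z powr t"
    using Q q by (simp add: powr_mult mult_ac)
  have "?N ?w / ?P ?w \<le> ?N ?w / (?P y powr (1 - t) * ?P z powr t)"
    using qpoch_inf_powr_mult_le[OF assms] pos[OF w] pos[OF yz(1)] pos[OF yz(2)] Q
    by (intro divide_left_mono) (auto intro!: mult_pos_pos mult_nonneg_nonneg)
  also have "\<dots> = (?N y / ?P y) powr (1 - t) * (?N z / ?P z) powr t"
    unfolding N using pos[OF yz(1)] pos[OF yz(2)] Q by (simp add: powr_divide)
  finally show ?thesis unfolding qGamma_def .
qed

section \<open>Coefficients of the Turanian\<close>

lemma qGamma_symmetric_pair_less:
  fixes k j :: nat
  assumes "0 < \<mu>" "0 < \<alpha>" "0 < \<beta>"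
  defines "G \<equiv> \<lambda>s i. qGamma q (\<mu> + s + real i)"
  shows "G \<alpha> k * G \<beta> j + G \<alpha> j * G \<beta> k < G 0 k * G (\<alpha> + \<beta>) j + G 0 j * G (\<alpha> + \<beta>) k"
\<comment> \<open>Swapping k and j only permutes the summands on each side, so k \<le> j may be
  assumed.\<close>
proof (induction k j rule: linorder_wlog)
  case (le k j)
  have pos: "0 < G s i" if "0 \<le> s" for s i
    unfolding G_def using that assms by (intro qGamma_pos) auto
  have pair: "G \<alpha> i * G \<beta> i < G 0 i * G (\<alpha> + \<beta>) i" for i
    using qGamma_mult_less[of "\<mu> + real i" \<alpha> \<beta>] assms by (simp add: G_def add_ac)
  show ?case
  \<comment> \<open>All four products have the same sum of arguments. As k \<le> j, the pair \<mu> +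
    k, \<mu> + \<alpha> + \<beta> + j is spread widest, so its product is taken as r.\<close>
  proof (rule add_less_add_of_mult_le)
    show "G \<alpha> k * G \<beta> j < G 0 k * G (\<alpha> + \<beta>) j"
      using qGamma_mult_less[of "\<mu> + real k" \<alpha> "\<beta> + real (j - k)"] assms le
      by (simp add: G_def of_nat_diff algebra_simps)
    show "G \<alpha> j * G \<beta> k < G 0 k * G (\<alpha> + \<beta>) j"
      using qGamma_mult_less[of "\<mu> + real k" "\<alpha> + real (j - k)" \<beta>] assms le
      by (simp add: G_def of_nat_diff algebra_simps)
    show "0 < G 0 k * G (\<alpha> + \<beta>) j" using assms(2,3) by (intro mult_pos_pos pos) auto
    \<comment> \<open>The bound u v \<le> r s is the product of the two equal-index inequalities
      \<open>pair\<close>, regrouped.\<close>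
    have "(G \<alpha> k * G \<beta> k) * (G \<alpha> j * G \<beta> j)
        \<le> (G 0 k * G (\<alpha> + \<beta>) k) * (G 0 j * G (\<alpha> + \<beta>) j)"
      using pair[of k] pair[of j] assms(2,3)
      by (intro mult_mono[OF less_imp_le less_imp_le] mult_nonneg_nonneg less_imp_le[OF pos]) auto
    then show "(G \<alpha> k * G \<beta> j) * (G \<alpha> j * G \<beta> k)
        \<le> (G 0 k * G (\<alpha> + \<beta>) j) * (G 0 j * G (\<alpha> + \<beta>) k)"
      by (simp add: mult_ac)
  qed
next
  case (sym k j)
  then show ?case by (simp add: add_ac)
qed

text \<open>A single \<open>M k (n - k)\<close> can have either sign, so the Cauchy sum is averaged
  with its reversal. If no k meets the condition for strictness, every summand vanishes and the
  coefficient is 0.\<close>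

lemma turanian_nth:
  fixes d :: "nat \<Rightarrow> real"
  assumes d: "\<And>n. 0 \<le> d n" and pos: "0 < \<mu>" "0 < \<alpha>" "0 < \<beta>"
  shows turanian_nth_nonpos: "fps_nth (turanian q d \<mu> \<alpha> \<beta>) n \<le> 0"
    and turanian_nth_neg: "\<exists>k\<le>n. d k \<noteq> 0 \<and> d (n - k) \<noteq> 0 \<Longrightarrow>
      fps_nth (turanian q d \<mu> \<alpha> \<beta>) n < 0"
proof -
  define G where "G = (\<lambda>s i. qGamma q (\<mu> + s + real i))"
  define M where "M k j = G \<alpha> k * G \<beta> j - G 0 k * G (\<alpha> + \<beta>) j" for k j
  let ?S = "\<lambda>k. d k * d (n - k) * (M k (n - k) + M (n - k) k)"
  have coeff: "fps_nth (turanian q d \<mu> \<alpha> \<beta>) n = (\<Sum>k=0..n. d k * d (n - k) * M k (n - k))"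
    unfolding turanian_def dseries_def fps_sub_nth fps_mult_nth sum_subtractf[symmetric]
    by (intro sum.cong) (auto simp: M_def G_def algebra_simps)
  also have "\<dots> = (\<Sum>k=0..n. d k * d (n - k) * M (n - k) k)"
    by (subst sum.atLeastAtMost_rev) (auto intro!: sum.cong simp: mult_ac)
  finally have two: "2 * fps_nth (turanian q d \<mu> \<alpha> \<beta>) n = (\<Sum>k=0..n. ?S k)"
    using coeff by (simp add: distrib_left sum.distrib)
  have M: "M k j + M j k < 0" for k j
    using qGamma_symmetric_pair_less[OF pos, of k j] by (simp add: M_def G_def)
  have S: "?S k \<le> 0" for k
    using d M by (intro mult_nonneg_nonpos) (auto intro: less_imp_le)
  show "fps_nth (turanian q d \<mu> \<alpha> \<beta>) n \<le> 0"
    using two S sum_nonpos[of "{0..n}" ?S] by simp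
  assume "\<exists>k\<le>n. d k \<noteq> 0 \<and> d (n - k) \<noteq> 0"
  then obtain k where k: "k \<le> n" "d k \<noteq> 0" "d (n - k) \<noteq> 0" by blast
  have "0 < d k * d (n - k)" using k d by (simp add: order_less_le)
  then have "?S k < 0" using M by (intro mult_pos_neg)
  then have "(\<Sum>k=0..n. ?S k) < (\<Sum>k=0..n. 0)"
    using S k by (intro sum_strict_mono_ex1) auto
  then show "fps_nth (turanian q d \<mu> \<alpha> \<beta>) n < 0" using two by simp
qed

section \<open>Convergence for one parameter and for all\<close>

text \<open>The powers of 1 - q have a ratio independent of n; the denominator at \<mu> + n is at
  least its value at \<mu>, and the one at \<nu> + n is at most 1. No order between \<mu> and \<nu>
  enters.\<close>

lemma qGamma_shift_le:
  assumes "0 < \<mu>" "0 < \<nu>"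
  shows "\<exists>C. \<forall>n::nat. qGamma q (\<mu> + n) \<le> C * qGamma q (\<nu> + n)"
proof (intro exI allI)
  fix n :: nat
  let ?P = "\<lambda>z. qpoch_inf (q powr z) q"
  let ?A = "(1 - q) powr (1 - (\<nu> + n)) * qpoch_inf q q"
  have pos: "0 < ?P z" if "0 < z" for z
    using q_powr_bounds[OF that] by (intro qpoch_inf_pos) auto
  have Q: "0 < qpoch_inf q q" using q by (intro qpoch_inf_pos) auto
  have A: "0 < ?A" using Q q by simp
  have le1: "?P \<mu> \<le> ?P (\<mu> + n)"
    using assms q q_powr_bounds[OF assms(1)] by (intro qpoch_inf_antimono powr_mono') auto
  \<comment> \<open>At base 0 every factor is 1, so this is the bound 1.\<close>
  have "?P (\<nu> + n) \<le> qpoch_inf 0 q"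
    using assms q_powr_bounds[of "\<nu> + n"] by (intro qpoch_inf_antimono) auto
  then have le2: "?P (\<nu> + n) \<le> 1" by (simp add: qpoch_inf_def qpoch_def)
  have split: "(1 - q) powr (1 - (\<mu> + n)) = (1 - q) powr (\<nu> - \<mu>) * (1 - q) powr (1 - (\<nu> + n))"
    by (simp add: algebra_simps flip: powr_add)
  have "qGamma q (\<mu> + n) = (1 - q) powr (\<nu> - \<mu>) * (?A / ?P (\<mu> + n))"
    unfolding qGamma_def split by simp
  also have "\<dots> \<le> (1 - q) powr (\<nu> - \<mu>) * ((?A / ?P (\<nu> + n)) / ?P \<mu>)"
  proof (intro mult_left_mono)
    have "?A / ?P (\<mu> + n) \<le> ?A / ?P \<mu>"
      using A le1 pos[OF assms(1)] pos[of "\<mu> + n"] assms by (intro divide_left_mono) auto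
    \<comment> \<open>Auxiliary: divided by \<open>?P \<mu>\<close>, this gives the next link of the
      chain.\<close>
    also have "?A \<le> ?A / ?P (\<nu> + n)"
      using A le2 pos[of "\<nu> + n"] assms mult_left_le[OF le2, of ?A] by (simp add: le_divide_eq)
    then have "?A / ?P \<mu> \<le> (?A / ?P (\<nu> + n)) / ?P \<mu>"
      using pos[OF assms(1)] by (intro divide_right_mono) auto
    finally show "?A / ?P (\<mu> + n) \<le> (?A / ?P (\<nu> + n)) / ?P \<mu>" .
  qed simp
  \<comment> \<open>The constant left open at the start is fixed here, and it is free of n.\<close>
  finally show "qGamma q (\<mu> + n) \<le> ((1 - q) powr (\<nu> - \<mu>) / ?P \<mu>) * qGamma q (\<nu> + n)"
    by (simp add: qGamma_def mult_ac)
qed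

text \<open>For x > 0 all terms are nonnegative, so the uniform bound on the ratio of q-gamma values
  allows the comparison test, boundary points included.\<close>

lemma conv_domain_dseries_shift:
  assumes d: "\<And>n. 0 \<le> d n" and "0 < x" "0 < \<mu>" "0 < \<nu>"
    and x: "x \<in> conv_domain (dseries q d \<nu>)"
  shows "x \<in> conv_domain (dseries q d \<mu>)"
proof -
  obtain C where C: "\<And>n::nat. qGamma q (\<mu> + n) \<le> C * qGamma q (\<nu> + n)"
    using qGamma_shift_le assms by blast
  have "summable (\<lambda>n. C * (d n * qGamma q (\<nu> + n) * x ^ n))"
    using x by (auto simp: conv_domain_def dseries_def intro: summable_mult)
  then have "summable (\<lambda>n. d n * qGamma q (\<mu> + n) * x ^ n)"
  proof (rule summable_comparison_test'[where N = 0])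
    fix n :: nat
    have "0 \<le> qGamma q (\<mu> + n)" using assms by (intro less_imp_le qGamma_pos) auto
    then have "norm (d n * qGamma q (\<mu> + n) * x ^ n) = d n * x ^ n * qGamma q (\<mu> + n)"
      using assms by (simp add: abs_mult)
    also have "\<dots> \<le> d n * x ^ n * (C * qGamma q (\<nu> + n))"
      using C assms by (intro mult_left_mono) auto
    finally show "norm (d n * qGamma q (\<mu> + n) * x ^ n) \<le> C * (d n * qGamma q (\<nu> + n) * x ^ n)"
      by (simp add: mult_ac)
  qed
  then show ?thesis by (simp add: conv_domain_def dseries_def)
qed

section \<open>Log-convexity of the sum in the parameter\<close>

lemma log_convex_on_eval_dseries:
  assumes d: "\<And>n. 0 \<le> d n" and nz: "d m \<noteq> 0" and x: "0 < x"
    and conv: "\<And>\<mu>. 0 < \<mu> \<Longrightarrow> x \<in> conv_domain (dseries q d \<mu>)"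
  shows "log_convex_on {0<..} (\<lambda>\<mu>. eval_fps (dseries q d \<mu>) x)"
proof -
  define T where "T \<mu> n = d n * qGamma q (\<mu> + real n) * x ^ n" for \<mu> n
  have eval: "eval_fps (dseries q d \<mu>) x = suminf (T \<mu>)" for \<mu>
    by (simp add: eval_fps_def dseries_def T_def [abs_def])
  have sm: "summable (T \<mu>)" if "0 < \<mu>" for \<mu>
    using conv[OF that] by (simp add: conv_domain_def dseries_def T_def [abs_def])
  have Gpos: "0 < qGamma q (\<mu> + real n)" if "0 < \<mu>" for \<mu> n
    using that by (intro qGamma_pos) auto
  have nonneg: "0 \<le> T \<mu> n" if "0 < \<mu>" for \<mu> n
    unfolding T_def using d x Gpos[OF that, of n] by simp
  have pos: "0 < suminf (T \<mu>)" if "0 < \<mu>" for \<mu>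
  \<comment> \<open>The single nonzero coefficient \<open>d m\<close> makes the sum, and hence the
    argument of \<open>ln\<close>, positive.\<close>
  proof (rule suminf_pos2[OF sm[OF that] nonneg[OF that]])
    show "0 < T \<mu> m"
      unfolding T_def using d[of m] nz x Gpos[OF that, of m] by simp
  qed
  have term_le: "T ((1 - t) * y + t * z) n \<le> T y n powr (1 - t) * T z n powr t"
    if t: "0 < t" "t < 1" and yz: "0 < y" "0 < z" for t y z n
  proof -
    \<comment> \<open>This distributes the common factor \<open>d n * x ^ n\<close> over both
      powers; the case c = 0 covers vanishing \<open>d n\<close>.\<close>
    have c: "c powr (1 - t) * c powr t = c" if "0 \<le> c" for c :: real
      using that by (cases "c = 0") (auto simp flip: powr_add)
    have "T ((1 - t) * y + t * z) n = d n * x ^ n * qGamma q ((1 - t) * (y + n) + t * (z + n))"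
      by (simp add: T_def algebra_simps)
    also have "\<dots> \<le> d n * x ^ n * (qGamma q (y + n) powr (1 - t) * qGamma q (z + n) powr t)"
      using t yz d x by (intro mult_left_mono qGamma_convex_comb_le) auto
    also have "\<dots> = (d n * x ^ n) powr (1 - t) * (d n * x ^ n) powr t *
        (qGamma q (y + n) powr (1 - t) * qGamma q (z + n) powr t)"
      using d x c by simp
    also have "\<dots> = (d n * x ^ n * qGamma q (y + n)) powr (1 - t) *
        (d n * x ^ n * qGamma q (z + n)) powr t"
      using d[of n] x Gpos[OF yz(1), of n] Gpos[OF yz(2), of n]
      by (subst (3 4) powr_mult) auto
    finally show ?thesis by (simp add: T_def mult_ac)
  qed
  have "convex_on {0<..} (\<lambda>\<mu>. ln (suminf (T \<mu>)))"
  proof (rule convex_onI)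
    fix t y z :: real
    assume t: "0 < t" "t < 1" and "y \<in> {0<..}" "z \<in> {0<..}"
    then have yz: "0 < y" "0 < z" by auto
    have w: "0 < (1 - t) * y + t * z" using t yz by (intro add_pos_pos mult_pos_pos) auto
    have "suminf (T ((1 - t) * y + t * z)) \<le> suminf (T y) powr (1 - t) * suminf (T z) powr t"
      using t yz w by (intro suminf_powr_Hoelder sm nonneg pos term_le) auto
    then have "ln (suminf (T ((1 - t) * y + t * z)))
        \<le> ln (suminf (T y) powr (1 - t) * suminf (T z) powr t)"
      using pos[OF w] pos[OF yz(1)] pos[OF yz(2)] by (subst ln_le_cancel_iff) auto
    also have "\<dots> = (1 - t) * ln (suminf (T y)) + t * ln (suminf (T z))"
      using pos[OF yz(1)] pos[OF yz(2)] by (simp add: ln_mult ln_powr)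
    finally show "ln (suminf (T ((1 - t) *\<^sub>R y + t *\<^sub>R z)))
        \<le> (1 - t) * ln (suminf (T y)) + t * ln (suminf (T z))"
      by simp
  qed (rule convex_real_interval)
  then show ?thesis unfolding log_convex_on_def eval using pos by auto
qed

end

text \<open>Strict negativity is asserted exactly where some product of \<open>d k\<close> and
  \<open>d (n - k)\<close> is nonzero. The zero sequence is excluded from the second half because
  its sum vanishes and has no logarithm.\<close>

theorem theorem2:
  fixes q :: real and d :: "nat \<Rightarrow> real"
  assumes "0 < q" and "q < 1"
    and "\<And>n. d n \<ge> 0"
  shows "(\<forall>\<mu>>0. \<forall>\<alpha>>0. \<forall>\<beta>>0. \<forall>n.
            fps_nth (turanian q d \<mu> \<alpha> \<beta>) n \<le> 0 \<and>
            ((\<exists>k\<le>n. d k \<noteq> 0 \<and> d (n - k) \<noteq> 0) \<longrightarrow> fps_nth (turanian q d \<mu> \<alpha> \<beta>) n < 0))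
       \<and> ((\<exists>n. d n \<noteq> 0) \<longrightarrow>
            (\<forall>x>0. (\<exists>\<nu>>0. x \<in> conv_domain (dseries q d \<nu>)) \<longrightarrow>
               (\<forall>\<mu>>0. x \<in> conv_domain (dseries q d \<mu>)) \<and>
               log_convex_on {0<..} (\<lambda>\<mu>. eval_fps (dseries q d \<mu>) x)))"
proof (intro conjI allI impI)
  show "fps_nth (turanian q d \<mu> \<alpha> \<beta>) n \<le> 0" if "0 < \<mu>" "0 < \<alpha>" "0 < \<beta>" for \<mu> \<alpha> \<beta> n
    using turanian_nth_nonpos assms that by blast
  show "fps_nth (turanian q d \<mu> \<alpha> \<beta>) n < 0"
    if "0 < \<mu>" "0 < \<alpha>" "0 < \<beta>" "\<exists>k\<le>n. d k \<noteq> 0 \<and> d (n - k) \<noteq> 0" for \<mu> \<alpha> \<beta> n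
    using turanian_nth_neg assms that by blast
  fix x :: real
  assume nz: "\<exists>n. d n \<noteq> 0" and x: "0 < x" and "\<exists>\<nu>>0. x \<in> conv_domain (dseries q d \<nu>)"
  then show conv: "x \<in> conv_domain (dseries q d \<mu>)" if "0 < \<mu>" for \<mu>
    using conv_domain_dseries_shift assms that by blast
  from nz obtain m where "d m \<noteq> 0" by blast
  then show "log_convex_on {0<..} (\<lambda>\<mu>. eval_fps (dseries q d \<mu>) x)"
    using log_convex_on_eval_dseries[OF assms(1,2)] assms(3) x conv by blast
qed

end
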